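(* Let $X$ be a nontrivial real Banach space, let $C\subseteq X$ be a nonempty, convex and closed set, and let $F:C\times C\to\mathbb{R}$ be a monotone bifunction with $F(x,x)=0$ for all $x\in C$. If $\operatorname{sqri}(C)\neq\emptyset$, $F(x,\cdot)$ is convex and lower semicontinuous for all $x\in C$ and $F(\cdot,y)$ is upper hemicontinuous for all $y\in C$, then $F$ is maximal monotone.
   Context: $X^*$ is the topological dual of $X$ and $\langle x^*,x\rangle$ the value of $x^*\in X^*$ at $x\in X$. For a convex set $U\subseteq X$, the strong quasi relative interior is $\operatorname{sqri}(U)=\{x\in U:\operatorname{cone}(U-x)\text{ is a closed linear subspace}\}$, where $\operatorname{cone}$ denotes the conical hull. A function is upper hemicontinuous if it is upper semicontinuous on line segments (of its domain of definition). A bifunction $F:C\times C\to\mathbb{R}$ is monotone if $F(x,y)+F(y,x)\le 0$ for all $x,y\in C$. The operator $A^F:X\rightrightarrows X^*$ is defined by $A^F(x)=\{x^*\in X^*:F(x,y)-F(x,x)\ge\langle x^*,y-x\rangle\ \forall y\in C\}$ if $x\in C$ and $A^F(x)=\emptyset$ if $x\notin C$. The monotone bifunction $F$ is maximal monotone if $A^F$ is a maximal monotone operator, i.e. $A^F$ is monotone ($\langle y^*-x^*,y-x\rangle\ge 0$ whenever $x^*\in A^F(x)$, $y^*\in A^F(y)$) and its graph is not properly included in the graph of another monotone operator $X\rightrightarrows X^*$. *)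

theory Defs
  imports "HOL-Analysis.Analysis"
begin

definition sqri :: "'a::real_normed_vector set \<Rightarrow> 'a set"
  where "sqri U =
    {x \<in> U. subspace (cone hull ((\<lambda>u. u - x) ` U)) \<and> closed (cone hull ((\<lambda>u. u - x) ` U))}"

definition usc_on :: "'a::topological_space set \<Rightarrow> ('a \<Rightarrow> real) \<Rightarrow> bool"
  where "usc_on S f \<longleftrightarrow> (\<forall>x\<in>S. \<forall>a. f x < a \<longrightarrow> (\<forall>\<^sub>F z in at x within S. f z < a))"

definition lsc_on :: "'a::topological_space set \<Rightarrow> ('a \<Rightarrow> real) \<Rightarrow> bool"
  where "lsc_on S f \<longleftrightarrow> (\<forall>x\<in>S. \<forall>a. a < f x \<longrightarrow> (\<forall>\<^sub>F z in at x within S. a < f z))"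

definition upper_hemicontinuous_on :: "'a::real_normed_vector set \<Rightarrow> ('a \<Rightarrow> real) \<Rightarrow> bool"
  where "upper_hemicontinuous_on C f \<longleftrightarrow>
    (\<forall>u v. closed_segment u v \<subseteq> C \<longrightarrow> usc_on (closed_segment u v) f)"

(* A bifunction on C \<times> C is represented by a curried total function; its values
   outside C \<times> C are irrelevant to all notions below. *)

definition monotone_bifunction :: "'a set \<Rightarrow> ('a \<Rightarrow> 'a \<Rightarrow> real) \<Rightarrow> bool"
  where "monotone_bifunction C F \<longleftrightarrow> (\<forall>x\<in>C. \<forall>y\<in>C. F x y + F y x \<le> 0)"

definition bifunction_operator ::
    "'a::real_normed_vector set \<Rightarrow> ('a \<Rightarrow> 'a \<Rightarrow> real) \<Rightarrow> 'a \<Rightarrow> ('a \<Rightarrow>\<^sub>L real) set"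
  where "bifunction_operator C F x =
    (if x \<in> C
     then {xs. \<forall>y\<in>C. F x y - F x x \<ge> blinfun_apply xs (y - x)}
     else {})"

definition operator_graph :: "('a \<Rightarrow> 'b set) \<Rightarrow> ('a \<times> 'b) set"
  where "operator_graph T = {(x, xs). xs \<in> T x}"

definition monotone_operator ::
    "('a::real_normed_vector \<Rightarrow> ('a \<Rightarrow>\<^sub>L real) set) \<Rightarrow> bool"
  where "monotone_operator T \<longleftrightarrow>
    (\<forall>x y. \<forall>xs\<in>T x. \<forall>ys\<in>T y. blinfun_apply (ys - xs) (y - x) \<ge> 0)"

definition maximal_monotone_operator ::
    "('a::real_normed_vector \<Rightarrow> ('a \<Rightarrow>\<^sub>L real) set) \<Rightarrow> bool"
  where "maximal_monotone_operator T \<longleftrightarrow>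
    monotone_operator T \<and>
    \<not> (\<exists>S. monotone_operator S \<and> operator_graph T \<subset> operator_graph S)"

definition maximal_monotone_bifunction ::
    "'a::real_normed_vector set \<Rightarrow> ('a \<Rightarrow> 'a \<Rightarrow> real) \<Rightarrow> bool"
  where "maximal_monotone_bifunction C F \<longleftrightarrow>
    monotone_bifunction C F \<and> maximal_monotone_operator (bifunction_operator C F)"

end

theory Submission
  imports Defs
begin

text \<open>
  Let \<open>p \<in> sqri C\<close> and let \<open>Y\<close> be the closed subspace \<open>cone (C - p)\<close>.
  By Baire's theorem in \<open>Y\<close>, each \<open>F x\<close> is bounded above on a relative neighbourhood of \<open>p\<close>,
  hence of every point \<open>y\<close> of a half-open segment from \<open>p\<close> towards \<open>C\<close>. Therefore, whenever
  \<open>F x (x + t d) \<ge> c t\<close> along the line in direction \<open>d = y - x\<close>, the Hahn--Banach theorem provides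
  an element \<open>u\<close> of \<open>A\<^sup>F x\<close> with \<open>u d = c\<close>.

  Let \<open>(z, v)\<close> be monotonically related to the graph of \<open>A\<^sup>F\<close>; replacing \<open>F x y\<close> by
  \<open>F x y - v (y - x)\<close> we may take \<open>v = 0\<close>. If \<open>x \<in> C\<close> lies strictly between \<open>z\<close> and \<open>y\<close>, then
  \<open>F x y \<ge> 0\<close>: otherwise a negative slope \<open>c\<close> at \<open>x\<close> yields \<open>u \<in> A\<^sup>F x\<close> with \<open>u (x - z) < 0\<close>.
  Upper hemicontinuity carries this over to the first point \<open>w\<close> of \<open>C\<close> on the segment from \<open>z\<close>
  to \<open>y\<close>. If \<open>z \<in> C\<close>, then \<open>w = z\<close>, so \<open>F z y \<ge> 0\<close>, and letting \<open>y\<close> tend to any point of \<open>C\<close>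
  gives \<open>0 \<in> A\<^sup>F z\<close>. If \<open>z \<notin> C\<close> but \<open>z - p \<in> Y\<close>, the slope \<open>-1\<close> is admissible at \<open>w\<close> in direction
  \<open>p - w\<close>, because the line leaves \<open>C\<close> at \<open>w\<close>, and the resulting element of \<open>A\<^sup>F w\<close> contradicts
  relatedness. If \<open>z - p \<notin> Y\<close>, every slope is admissible at \<open>p\<close> in direction \<open>p - z\<close>.
\<close>

section \<open>Sublinear functionals\<close>

definition sublinear :: "('a::real_vector \<Rightarrow> real) \<Rightarrow> bool"
  where "sublinear p \<longleftrightarrow>
    (\<forall>x y. p (x + y) \<le> p x + p y) \<and> (\<forall>c x. 0 \<le> c \<longrightarrow> p (c *\<^sub>R x) = c * p x)"

lemma sublinear_add: "sublinear p \<Longrightarrow> p (x + y) \<le> p x + p y"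
  by (simp add: sublinear_def)

lemma sublinear_scale: "sublinear p \<Longrightarrow> 0 \<le> c \<Longrightarrow> p (c *\<^sub>R x) = c * p x"
  by (simp add: sublinear_def)

lemma sublinear_zero: "sublinear p \<Longrightarrow> p 0 = 0"
  using sublinear_scale[of p 0 0] by simp

lemma sublinear_minus: "sublinear p \<Longrightarrow> - p (- x) \<le> p x"
  using sublinear_add[of p x "- x"] by (simp add: sublinear_zero)

text \<open>Applying \<open>scale\<close> to \<open>inverse c\<close> and
  \<open>c *\<^sub>R x\<close> gives the reverse inequality, so one direction suffices.\<close>

lemma sublinearI:
  assumes add: "\<And>x y. p (x + y) \<le> p x + p y"
    and scale: "\<And>c x. 0 < c \<Longrightarrow> p (c *\<^sub>R x) \<le> c * p x"
    and zero: "p 0 = 0"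
  shows "sublinear p"
proof -
  have "p (c *\<^sub>R x) = c * p x" if "0 \<le> c" for c x
  proof (cases "c = 0")
    case False
    with that have c: "0 < c" by simp
    have "p (inverse c *\<^sub>R c *\<^sub>R x) \<le> inverse c * p (c *\<^sub>R x)"
      using scale[of "inverse c"] c by (simp only: positive_imp_inverse_positive)
    then have "c * p x \<le> p (c *\<^sub>R x)"
      using c by (simp add: field_simps)
    with scale[OF c, of x] show ?thesis by simp
  qed (simp add: zero)
  with add show ?thesis by (simp add: sublinear_def)
qed

text \<open>The infimum of \<open>p (v + w) + k\<close> over \<open>G\<close> is the largest such
  \<open>q\<close>. It serves twice: with a ray for \<open>G\<close>, to show that minimal
  functionals are odd, and with a generated cone, for \<open>Mazur_Orlicz\<close>.\<close>

lemma sublinear_inf_convolution: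
  fixes p :: "'a::real_vector \<Rightarrow> real" and G :: "('a \<times> real) set"
  assumes p: "sublinear p" and G: "convex_cone G"
    and nonneg: "\<And>w k. (w, k) \<in> G \<Longrightarrow> 0 \<le> p w + k"
  obtains q where "sublinear q" "\<And>v. q v \<le> p v" "\<And>w k. (w, k) \<in> G \<Longrightarrow> q (- w) \<le> k"
proof -
  define q where "q v = (INF g\<in>G. p (v + fst g) + snd g)" for v
  have G0: "(0, 0) \<in> G"
    using convex_cone_contains_0[OF G] by (simp add: zero_prod_def)
  have Gadd: "g + h \<in> G" if "g \<in> G" "h \<in> G" for g h
    using convex_cone_add[OF G] that by blast
  have Gscale: "c *\<^sub>R g \<in> G" if "g \<in> G" "0 \<le> c" for c g
    using convex_cone_scaleR[OF G] that by blast
  \<comment> \<open>Writing \<open>fst g\<close> as the sum of \<open>v + fst g\<close> and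
    \<open>- v\<close> turns \<open>nonneg\<close> into a bound independent of \<open>g\<close>, so
    the infimum is finite.\<close>
  have lower: "- p (- v) \<le> p (v + fst g) + snd g" if "g \<in> G" for v g
    using nonneg[of "fst g" "snd g"] sublinear_add[OF p, of "v + fst g" "- v"] that by simp
  then have bdd: "bdd_below ((\<lambda>g. p (v + fst g) + snd g) ` G)" for v
    by (intro bdd_belowI2[of _ "- p (- v)"])
  have qle': "q v \<le> p (v + fst g) + snd g" if "g \<in> G" for v g
    using cINF_lower[OF bdd that, of v] by (simp add: q_def)
  have qle: "q v \<le> p (v + w) + k" if "(w, k) \<in> G" for v w k
    using qle'[OF that] by simp
  have "q 0 = 0"
  proof (rule antisym)
    show "q 0 \<le> 0" using qle[OF G0, of 0] by (simp add: sublinear_zero[OF p])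
    show "0 \<le> q 0" unfolding q_def
      using lower[of _ 0] G0 by (intro cINF_greatest) (auto simp: sublinear_zero[OF p])
  qed
  moreover have "q (x + y) \<le> q x + q y" for x y
  proof (rule field_le_epsilon)
    fix e :: real assume e: "0 < e"
    have "\<exists>g\<in>G. p (v + fst g) + snd g < q v + e / 2" for v
      using cINF_less_iff[OF _ bdd, of v "q v + e / 2"] G0 e by (auto simp: q_def)
    then obtain g h where g: "g \<in> G" "p (x + fst g) + snd g < q x + e / 2"
      and h: "h \<in> G" "p (y + fst h) + snd h < q y + e / 2" by meson
    have "q (x + y) \<le> p (x + y + fst (g + h)) + snd (g + h)"
      by (rule qle'[OF Gadd[OF g(1) h(1)]])
    also have "\<dots> \<le> p (x + fst g) + p (y + fst h) + (snd g + snd h)"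
      using sublinear_add[OF p, of "x + fst g" "y + fst h"] by (simp add: algebra_simps)
    finally show "q (x + y) \<le> q x + q y + e" using g(2) h(2) by simp
  qed
  moreover have "q (c *\<^sub>R x) \<le> c * q x" if c: "0 < c" for c x
  proof -
    have "q (c *\<^sub>R x) / c \<le> p (x + fst g) + snd g" if "g \<in> G" for g
    proof -
      have "q (c *\<^sub>R x) \<le> p (c *\<^sub>R x + fst (c *\<^sub>R g)) + snd (c *\<^sub>R g)"
        using c by (intro qle' Gscale that) simp
      also have "\<dots> = c * (p (x + fst g) + snd g)"
        using sublinear_scale[OF p, of c "x + fst g"] c by (simp add: algebra_simps)
      finally show ?thesis using c by (simp add: field_simps)
    qed
    then have "q (c *\<^sub>R x) / c \<le> q x"
      unfolding q_def[of x] using G0 by (intro cINF_greatest) auto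
    then show ?thesis using c by (simp add: field_simps)
  qed
  ultimately have "sublinear q" by (intro sublinearI)
  moreover have "q v \<le> p v" for v using qle[OF G0, of v] by simp
  moreover have "q (- w) \<le> k" if "(w, k) \<in> G" for w k
    using qle[OF that, of "- w"] by (simp add: sublinear_zero[OF p])
  ultimately show ?thesis by (rule that)
qed

text \<open>Supplies the bounds for Zorn's lemma. Members dominate \<open>- p (- v)\<close> at
  \<open>v\<close>, so the infimum is finite; the chain condition lets one member replace two
  near-minimisers at \<open>x\<close> and \<open>y\<close>.\<close>

lemma sublinear_chain_inf:
  fixes p :: "'a::real_vector \<Rightarrow> real"
  assumes "K \<noteq> {}" and K: "\<And>q. q \<in> K \<Longrightarrow> sublinear q \<and> (\<forall>v. q v \<le> p v)"
    and chain: "\<And>q r. q \<in> K \<Longrightarrow> r \<in> K \<Longrightarrow> (\<forall>v. q v \<le> r v) \<or> (\<forall>v. r v \<le> q v)"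
  obtains m where "sublinear m" "\<And>q v. q \<in> K \<Longrightarrow> m v \<le> q v"
proof -
  define m where "m v = (INF q\<in>K. q v)" for v
  have "- p (- v) \<le> q v" if "q \<in> K" for q v
    using sublinear_minus[of q v] K[OF that] by (meson neg_le_iff_le order_trans)
  then have bdd: "bdd_below ((\<lambda>q. q v) ` K)" for v
    by (intro bdd_belowI2[of _ "- p (- v)"])
  have m_le: "m v \<le> q v" if "q \<in> K" for q v
    using cINF_lower[OF bdd that] by (simp add: m_def)
  have "m 0 = (INF q\<in>K. 0)"
    unfolding m_def using K sublinear_zero by (intro INF_cong) auto
  then have "m 0 = 0" using \<open>K \<noteq> {}\<close> by simp
  moreover have "m (x + y) \<le> m x + m y" for x y
  proof (rule field_le_epsilon)
    fix e :: real assume e: "0 < e"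
    have "\<exists>q\<in>K. q v < m v + e / 2" for v
      using cINF_less_iff[OF \<open>K \<noteq> {}\<close> bdd, of v "m v + e / 2"] e by (auto simp: m_def)
    then obtain q r where q: "q \<in> K" "q x < m x + e / 2" and r: "r \<in> K" "r y < m y + e / 2"
      by meson
    then obtain s where s: "s \<in> K" "s x \<le> q x" "s y \<le> r y"
      using chain[OF q(1) r(1)] by (metis order_refl)
    have "m (x + y) \<le> s x + s y"
      using m_le[OF s(1), of "x + y"] sublinear_add[of s x y] K[OF s(1)] by simp
    then show "m (x + y) \<le> m x + m y + e" using q(2) r(2) s by simp
  qed
  moreover have "m (c *\<^sub>R x) \<le> c * m x" if c: "0 < c" for c x
  proof -
    have "m (c *\<^sub>R x) / c \<le> q x" if "q \<in> K" for q
      using m_le[OF that, of "c *\<^sub>R x"] sublinear_scale[of q c x] K[OF that] c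
      by (simp add: field_simps)
    then have "m (c *\<^sub>R x) / c \<le> m x"
      unfolding m_def[of x] using \<open>K \<noteq> {}\<close> by (intro cINF_greatest) auto
    then show ?thesis using c by (simp add: field_simps)
  qed
  ultimately have "sublinear m" by (intro sublinearI)
  with m_le show ?thesis by (intro that)
qed

section \<open>Hahn-Banach and Mazur-Orlicz theorems\<close>

text \<open>Zorn's lemma gives a minimal sublinear functional below \<open>p\<close>; minimality
  forces it to be odd, and odd sublinear functionals are linear.\<close>

lemma sublinear_linear_minorant:
  fixes p :: "'a::real_vector \<Rightarrow> real"
  assumes p: "sublinear p"
  obtains L where "linear L" "\<And>v. L v \<le> p v"
proof -
  define A where "A = {q. sublinear q \<and> (\<forall>v. q v \<le> p v)}"
  \<comment> \<open>The order is reversed, so a maximal element is pointwise minimal.\<close>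
  define P where "P = (\<lambda>q r :: 'a \<Rightarrow> real. \<forall>v. r v \<le> q v)"
  have "\<exists>m\<in>A. \<forall>q\<in>A. P m q \<longrightarrow> q = m"
  proof (rule predicate_Zorn)
    show "partial_order_on A (relation_of P A)"
    proof (rule partial_order_on_relation_ofI)
      show "P q s" if "P q r" "P r s" for q r s
        using that unfolding P_def by (meson order_trans)
      show "q = r" if "P q r" "P r q" for q r
        using that unfolding P_def by (intro ext antisym) auto
    qed (simp add: P_def)
  next
    fix K assume K: "K \<in> Chains (relation_of P A)"
    then have KA: "K \<subseteq> A"
      by (auto simp: Chains_def relation_of_def)
    show "\<exists>u\<in>A. \<forall>a\<in>K. P a u"
    proof (cases "K = {}")
      case True
      then show ?thesis using p by (auto simp: A_def)
    next
      case False
      obtain m where m: "sublinear m" "\<And>q v. q \<in> K \<Longrightarrow> m v \<le> q v"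
      proof (rule sublinear_chain_inf[OF False, of p])
        show "(\<forall>v. q v \<le> r v) \<or> (\<forall>v. r v \<le> q v)" if "q \<in> K" "r \<in> K" for q r
          using K that by (auto simp: Chains_def relation_of_def P_def)
      qed (use KA A_def in auto)
      obtain q where "q \<in> K" using False by blast
      then have "m v \<le> p v" for v
        using m(2)[of q v] KA by (force simp: A_def intro: order_trans)
      with m show ?thesis by (auto simp: A_def P_def)
    qed
  qed
  then obtain m where "m \<in> A" and max: "\<And>q. q \<in> A \<Longrightarrow> P m q \<Longrightarrow> q = m"
    by blast
  then have m: "sublinear m" "\<And>v. m v \<le> p v"
    by (auto simp: A_def)
  have min: "q = m" if "sublinear q" "\<And>v. q v \<le> m v" for q
  proof (rule max)
    show "q \<in> A" using that m(2) unfolding A_def by (blast intro: order_trans)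
    show "P m q" using that by (simp add: P_def)
  qed
  \<comment> \<open>Pushing \<open>m\<close> down along the ray through \<open>(e, - m e)\<close> cannot change it, so \<open>m (- e) \<le> - m e\<close>.\<close>
  have odd: "m (- e) = - m e" for e
  proof -
    define G where "G = (\<lambda>c. c *\<^sub>R (e, - m e)) ` {0..}"
    have "convex_cone G"
      unfolding convex_cone_iff
    proof (intro conjI ballI allI impI)
      fix x y assume "x \<in> G" "y \<in> G"
      then obtain a b where "0 \<le> a" "0 \<le> b" "x = a *\<^sub>R (e, - m e)" "y = b *\<^sub>R (e, - m e)"
        by (auto simp: G_def)
      then show "x + y \<in> G"
        by (auto simp: G_def scaleR_left_distrib algebra_simps intro!: image_eqI[of _ _ "a + b"])
    next
      fix x and c :: real assume "x \<in> G" "0 \<le> c"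
      then obtain a where "0 \<le> a" "x = a *\<^sub>R (e, - m e)" by (auto simp: G_def)
      with \<open>0 \<le> c\<close> show "c *\<^sub>R x \<in> G"
        by (auto simp: G_def intro!: image_eqI[of _ _ "c * a"])
    qed (auto simp: G_def zero_prod_def intro!: image_eqI[of _ _ 0])
    moreover have "0 \<le> m w + k" if "(w, k) \<in> G" for w k
      using that by (auto simp: G_def sublinear_scale[OF m(1)])
    ultimately obtain q where q: "sublinear q" "\<And>v. q v \<le> m v"
      "\<And>w k. (w, k) \<in> G \<Longrightarrow> q (- w) \<le> k"
      using sublinear_inf_convolution[OF m(1)] by metis
    have "(e, - m e) \<in> G" by (auto simp: G_def intro!: image_eqI[of _ _ 1])
    with q(3) min[OF q(1,2)] have "m (- e) \<le> - m e" by auto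
    with sublinear_minus[OF m(1), of e] show ?thesis by simp
  qed
  have "linear m"
  proof (rule linearI)
    fix x y show "m (x + y) = m x + m y"
      using sublinear_add[OF m(1), of x y] sublinear_add[OF m(1), of "- x" "- y"] odd[of "x + y"]
        odd[of x] odd[of y] by simp
  next
    fix c x show "m (c *\<^sub>R x) = c *\<^sub>R m x"
      using sublinear_scale[OF m(1), of c x] sublinear_scale[OF m(1), of "- c" x]
        odd[of "c *\<^sub>R x"] by (cases "0 \<le> c") auto
  qed
  with m(2) show ?thesis by (intro that)
qed

text \<open>Infimal convolution over the cone generated by \<open>K\<close> encodes the constraints
  in a smaller sublinear \<open>q\<close>; any linear minorant \<open>L\<close> of \<open>q\<close>
  then works, as \<open>L (- w) \<le> q (- w) \<le> k\<close>.\<close>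

lemma Mazur_Orlicz:
  fixes p :: "'a::real_vector \<Rightarrow> real" and K :: "('a \<times> real) set"
  assumes p: "sublinear p" and K: "convex K" "K \<noteq> {}"
    and nonneg: "\<And>w k. (w, k) \<in> K \<Longrightarrow> 0 \<le> p w + k"
  obtains L where "linear L" "\<And>v. L v \<le> p v" "\<And>w k. (w, k) \<in> K \<Longrightarrow> 0 \<le> L w + k"
proof -
  have "0 \<le> p w + k" if wk: "(w, k) \<in> cone hull K" for w k
  proof -
    obtain c g where "0 \<le> c" "g \<in> K" "(w, k) = c *\<^sub>R g"
      using wk by (auto simp: cone_hull_expl)
    then show ?thesis
      using nonneg[of "fst g" "snd g"] sublinear_scale[OF p, of c "fst g"]
        distrib_left[of c "p (fst g)" "snd g"] mult_nonneg_nonneg[of c "p (fst g) + snd g"]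
      by (cases g) auto
  qed
  moreover have "convex_cone (cone hull K)"
    using K convex_cone_hull[OF K(1)] cone_cone_hull[of K] cone_hull_contains_0[of K]
    by (simp add: convex_cone_iff) (metis convex_cone cone_def)
  ultimately obtain q where q: "sublinear q" "\<And>v. q v \<le> p v"
    "\<And>w k. (w, k) \<in> cone hull K \<Longrightarrow> q (- w) \<le> k"
    using sublinear_inf_convolution[OF p] by metis
  obtain L where L: "linear L" "\<And>v. L v \<le> q v"
    using sublinear_linear_minorant[OF q(1)] by blast
  show ?thesis
  proof (rule that[OF L(1)])
    show "L v \<le> p v" for v using L(2)[of v] q(2)[of v] by simp
    show "0 \<le> L w + k" if "(w, k) \<in> K" for w k
    proof -
      have "q (- w) \<le> k" using q(3) that hull_inc by metis
      then show ?thesis using L(2)[of "- w"] linear_neg[OF L(1), of w] by simp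
    qed
  qed
qed

section \<open>Subgradients and semicontinuity\<close>

text \<open>The slope \<open>c\<close> is the right derivative at \<open>x\<close> along
  \<open>d\<close>. The point \<open>x - b *\<^sub>R d\<close> supplies a left slope, which bounds
  all right slopes from below.\<close>

lemma convex_on_line_subgradient:
  fixes x d :: "'a::real_vector"
  assumes f: "convex_on C f" and x: "x \<in> C" "f x = 0"
    and b: "0 < b" "x - b *\<^sub>R d \<in> C" and d: "x + d \<in> C"
  obtains c where "c \<le> f (x + d)" "\<And>t. x + t *\<^sub>R d \<in> C \<Longrightarrow> c * t \<le> f (x + t *\<^sub>R d)"
proof -
  define S where "S = {t. 0 < t \<and> x + t *\<^sub>R d \<in> C}"
  define c where "c = (INF t\<in>S. f (x + t *\<^sub>R d) / t)"
  have "1 \<in> S" using d by (simp add: S_def)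
  have slopes: "- f (x - s *\<^sub>R d) / s \<le> f (x + t *\<^sub>R d) / t"
    if "t \<in> S" "0 < s" "x - s *\<^sub>R d \<in> C" for s t
  proof -
    have t: "0 < t" "x + t *\<^sub>R d \<in> C" using that by (auto simp: S_def)
    \<comment> \<open>This weight makes \<open>x\<close> the convex combination of
      \<open>x - s *\<^sub>R d\<close> and \<open>x + t *\<^sub>R d\<close>.\<close>
    define a where "a = s / (s + t)"
    have a: "0 \<le> a" "a \<le> 1" "1 - a = t / (s + t)"
      using t that by (auto simp: a_def field_simps)
    have "(1 - a) *\<^sub>R (x - s *\<^sub>R d) + a *\<^sub>R (x + t *\<^sub>R d) = x + (a * t - (1 - a) * s) *\<^sub>R d"
      by (simp add: algebra_simps)
    also have "a * t - (1 - a) * s = 0"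
      unfolding a(3) by (simp add: a_def)
    finally have "0 \<le> (1 - a) * f (x - s *\<^sub>R d) + a * f (x + t *\<^sub>R d)"
      using convex_onD[OF f a(1,2) that(3) t(2)] x(2) by simp
    also have "\<dots> = (t * f (x - s *\<^sub>R d) + s * f (x + t *\<^sub>R d)) / (s + t)"
      unfolding a(3) by (simp add: a_def add_divide_distrib)
    finally show ?thesis using t that by (simp add: field_simps zero_le_divide_iff)
  qed
  have "bdd_below ((\<lambda>t. f (x + t *\<^sub>R d) / t) ` S)"
    using slopes[OF _ b] by (intro bdd_belowI2) auto
  then have c_le: "c \<le> f (x + t *\<^sub>R d) / t" if "t \<in> S" for t
    unfolding c_def using that by (rule cINF_lower)
  show ?thesis
  proof (rule that)
    show "c \<le> f (x + d)" using c_le[OF \<open>1 \<in> S\<close>] by simp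
    fix t assume t: "x + t *\<^sub>R d \<in> C"
    consider "0 < t" | "t = 0" | "t < 0" by linarith
    then show "c * t \<le> f (x + t *\<^sub>R d)"
    proof cases
      case 1
      with t c_le[of t] show ?thesis by (simp add: S_def field_simps)
    next
      case 3
      have "- f (x - (- t) *\<^sub>R d) / (- t) \<le> c"
        unfolding c_def using \<open>1 \<in> S\<close> slopes[of _ "- t"] 3 t by (intro cINF_greatest) auto
      with 3 show ?thesis by (simp add: field_simps)
    qed (simp add: x)
  qed
qed

text \<open>\<open>calm\<close> is the nonnegativity hypothesis of \<open>Mazur_Orlicz\<close> for
  \<open>K\<close>, so some \<open>L\<close> satisfies
  \<open>0 \<le> s * L d - L (e - x) + f e - c * s\<close>. Taking \<open>e = x\<close> with
  \<open>s\<close> of both signs forces \<open>L d = c\<close>; \<open>s = 0\<close> gives the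
  subgradient inequality.\<close>

lemma subgradient_prescribed_on_line:
  fixes x d :: "'a::real_normed_vector"
  assumes f: "convex_on C f" and x: "x \<in> C" "f x = 0" and M: "0 \<le> M"
    and calm: "\<And>e s. e \<in> C \<Longrightarrow> c * s - f e \<le> M * norm (e - x - s *\<^sub>R d)"
  obtains u :: "'a \<Rightarrow>\<^sub>L real" where "\<And>e. e \<in> C \<Longrightarrow> u (e - x) \<le> f e" "u d = c"
proof -
  \<comment> \<open>Admitting every \<open>r\<close> above \<open>f e - c * s\<close> makes
    \<open>K\<close> convex.\<close>
  define K where "K = {(x + s *\<^sub>R d - e, r) | s e r. e \<in> C \<and> f e - c * s \<le> r}"
  have KI: "(x + s *\<^sub>R d - e, f e - c * s) \<in> K" if "e \<in> C" for s e
    using that unfolding K_def by blast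
  have p: "sublinear (\<lambda>v. M * norm v)"
    using M by (intro sublinearI)
      (auto simp: distrib_left[symmetric] intro: mult_left_mono norm_triangle_ineq)
  have conv: "convex K"
  proof (rule convexI)
    fix g h and a b :: real
    assume g: "g \<in> K" and h: "h \<in> K" and ab: "0 \<le> a" "0 \<le> b" "a + b = 1"
    from g obtain s e r where 1: "e \<in> C" "f e - c * s \<le> r" "g = (x + s *\<^sub>R d - e, r)"
      by (auto simp: K_def)
    from h obtain s' e' r' where 2: "e' \<in> C" "f e' - c * s' \<le> r'" "h = (x + s' *\<^sub>R d - e', r')"
      by (auto simp: K_def)
    have "a *\<^sub>R e + b *\<^sub>R e' \<in> C"
      using convexD[OF convex_on_imp_convex[OF f] 1(1) 2(1) ab] .
    moreover have "f (a *\<^sub>R e + b *\<^sub>R e') \<le> a * f e + b * f e'"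
      using f 1(1) 2(1) ab unfolding convex_on_def by blast
    then have "f (a *\<^sub>R e + b *\<^sub>R e') - c * (a * s + b * s') \<le> a * r + b * r'"
      using mult_left_mono[OF 1(2) ab(1)] mult_left_mono[OF 2(2) ab(2)]
      by (simp add: algebra_simps)
    moreover have "a *\<^sub>R (x + s *\<^sub>R d - e) + b *\<^sub>R (x + s' *\<^sub>R d - e') =
        x + (a * s + b * s') *\<^sub>R d - (a *\<^sub>R e + b *\<^sub>R e')"
      using scaleR_left_distrib[of a b x] ab(3) by (simp add: algebra_simps)
    ultimately show "a *\<^sub>R g + b *\<^sub>R h \<in> K"
      unfolding K_def 1(3) 2(3) by auto
  qed
  have "0 \<le> M * norm w + k" if wk: "(w, k) \<in> K" for w k
  proof -
    obtain s e where se: "e \<in> C" "f e - c * s \<le> k" "w = x + s *\<^sub>R d - e"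
      using wk unfolding K_def by blast
    have "norm (e - x - s *\<^sub>R d) = norm w"
      using norm_minus_commute[of e "x + s *\<^sub>R d"] by (simp add: se(3) diff_diff_add)
    with calm[OF se(1), of s] se(2) show ?thesis by simp
  qed
  then obtain L where L: "linear L" "\<And>v. L v \<le> M * norm v"
    "\<And>w k. (w, k) \<in> K \<Longrightarrow> 0 \<le> L w + k"
    using Mazur_Orlicz[OF p conv] KI[OF x(1)] by blast
  have "\<bar>L v\<bar> \<le> norm v * M" for v
    using L(2)[of v] L(2)[of "- v"] linear_neg[OF L(1), of v] by (auto simp: mult.commute)
  then have bl: "bounded_linear L"
    using L(1) by (intro bounded_linear_intro[of L M]) (auto simp: linear_add linear_scale)
  have "0 \<le> s * (L d - c)" for s
    using L(3)[OF KI[OF x(1), of s]] x(2) linear_scale[OF L(1), of s d] by (simp add: algebra_simps)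
  from this[of 1] this[of "- 1"] have "L d = c" by simp
  moreover have "L (e - x) \<le> f e" if "e \<in> C" for e
    using L(3)[OF KI[OF that, of 0]] linear_diff[OF L(1)] by simp
  ultimately show ?thesis
    using that[of "Blinfun L"] by (simp add: bounded_linear_Blinfun_apply[OF bl])
qed

section \<open>Baire category and semicontinuity\<close>

text \<open>A closed subset of a Banach space is completely metrizable, so Baire's theorem applies
  in its relative topology.\<close>

lemma Baire_closed:
  fixes Y :: "'a::banach set"
  assumes "closed Y" "Y \<noteq> {}" and T: "\<And>n::nat. closed (T n)" "\<And>n. T n \<subseteq> Y" "Y \<subseteq> (\<Union>n. T n)"
  obtains n v r where "0 < r" "v \<in> Y" "Y \<inter> cball v r \<subseteq> T n"
proof -
  have "completely_metrizable_space (top_of_set Y)"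
    using \<open>closed Y\<close> completely_metrizable_space_closedin completely_metrizable_space_euclidean
    by (metis closed_closedin)
  moreover have "top_of_set Y interior_of (\<Union>(range T)) \<noteq> {}"
  proof -
    have "\<Union>(range T) = Y" using T by blast
    then show ?thesis using \<open>Y \<noteq> {}\<close> interior_of_topspace[of "top_of_set Y"] by simp
  qed
  moreover have "closedin (top_of_set Y) (T n)" for n
    using T by (simp add: closed_subset)
  ultimately obtain n where "top_of_set Y interior_of T n \<noteq> {}"
    using Baire_category_alt[of "top_of_set Y" "range T"] by auto
  then obtain v U where "openin (top_of_set Y) U" "U \<subseteq> T n" "v \<in> U"
    by (auto simp: interior_of_def)
  then obtain r where "0 < r" "Y \<inter> cball v r \<subseteq> T n" "v \<in> Y"
    using openin_contains_cball[of Y U] by (metis Int_commute order_trans subset_iff)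
  then show ?thesis by (intro that)
qed

lemma closed_sublevel_lsc_on:
  fixes f :: "'a::t1_space \<Rightarrow> real"
  assumes "closed C" and f: "lsc_on C f"
  shows "closed {x \<in> C. f x \<le> a}"
proof (unfold closed_limpt, intro allI impI)
  fix x assume x: "x islimpt {x \<in> C. f x \<le> a}"
  then have "x \<in> C"
    using islimpt_subset[OF x, of C] \<open>closed C\<close> by (auto simp: closed_limpt)
  moreover have "\<not> a < f x"
  proof
    assume "a < f x"
    with f \<open>x \<in> C\<close> have "\<forall>\<^sub>F z in at x within C. a < f z"
      by (simp add: lsc_on_def)
    then have "\<forall>\<^sub>F z in at x within {x \<in> C. f x \<le> a}. False"
      unfolding eventually_at_filter by (rule eventually_mono) auto
    then show False
      using x by (simp add: eventually_False trivial_limit_within)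
  qed
  ultimately show "x \<in> {x \<in> C. f x \<le> a}" by simp
qed

lemma lsc_on_add_continuous:
  assumes f: "lsc_on S f" and g: "continuous_on S g"
  shows "lsc_on S (\<lambda>x. f x + g x)"
  unfolding lsc_on_def
proof (intro ballI allI impI)
  fix x a assume x: "x \<in> S" and a: "a < f x + g x"
  define e where "e = (f x + g x - a) / 2"
  have "\<forall>\<^sub>F z in at x within S. f x - e < f z"
    using f x a by (simp add: lsc_on_def e_def)
  moreover have "\<forall>\<^sub>F z in at x within S. g x - e < g z"
    using g x a by (intro order_tendstoD) (auto simp: continuous_on_def e_def)
  ultimately show "\<forall>\<^sub>F z in at x within S. a < f z + g z"
    by eventually_elim (auto simp: e_def field_simps)
qed

lemma usc_on_iff_lsc_on_minus: "usc_on S f \<longleftrightarrow> lsc_on S (\<lambda>x. - f x)"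
  unfolding usc_on_def lsc_on_def
proof (intro ball_cong refl iffI allI impI)
  fix x a assume "\<forall>a. f x < a \<longrightarrow> (\<forall>\<^sub>F z in at x within S. f z < a)" "a < - f x"
  then have "f x < - a \<longrightarrow> (\<forall>\<^sub>F z in at x within S. f z < - a)" by blast
  with \<open>a < - f x\<close> have "\<forall>\<^sub>F z in at x within S. f z < - a" by simp
  then show "\<forall>\<^sub>F z in at x within S. a < - f z"
    by (rule eventually_mono) simp
next
  fix x a assume "\<forall>a. a < - f x \<longrightarrow> (\<forall>\<^sub>F z in at x within S. a < - f z)" "f x < a"
  then have "- a < - f x \<longrightarrow> (\<forall>\<^sub>F z in at x within S. - a < - f z)" by blast
  with \<open>f x < a\<close> show "\<forall>\<^sub>F z in at x within S. f z < a" by simp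
qed

lemma usc_on_add_continuous:
  assumes "usc_on S f" and "continuous_on S g"
  shows "usc_on S (\<lambda>x. f x + g x)"
proof -
  have "lsc_on S (\<lambda>x. - f x + - g x)"
    using assms by (intro lsc_on_add_continuous continuous_on_minus)
      (simp_all add: usc_on_iff_lsc_on_minus)
  then show ?thesis by (simp add: usc_on_iff_lsc_on_minus)
qed

section \<open>Bifunctions on a set with nonempty strong quasi relative interior\<close>

text \<open>The hypotheses are bundled so that they can be instantiated both for \<open>F\<close>
  and for \<open>F\<close> shifted by a continuous functional.\<close>

locale sqri_bifunction =
  fixes C :: "'a::banach set" and F :: "'a \<Rightarrow> 'a \<Rightarrow> real" and p :: 'a
  assumes closed_C: "closed C"
    and diag: "x \<in> C \<Longrightarrow> F x x = 0"
    and sqri: "p \<in> sqri C"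
    and convex_F: "x \<in> C \<Longrightarrow> convex_on C (F x)"
    and lsc_F: "x \<in> C \<Longrightarrow> lsc_on C (F x)"
    and uhc_F: "y \<in> C \<Longrightarrow> upper_hemicontinuous_on C (\<lambda>x. F x y)"
begin

definition Y where "Y = cone hull ((\<lambda>u. u - p) ` C)"

lemma p_in_C: "p \<in> C" and subspace_Y: "subspace Y" and closed_Y: "closed Y"
  using sqri by (auto simp: sqri_def Y_def)

lemma convex_C: "convex C"
  using convex_F[OF p_in_C] by (rule convex_on_imp_convex)

lemma convex_combination:
  "\<lbrakk>0 \<le> t; t \<le> 1; x \<in> C; y \<in> C\<rbrakk> \<Longrightarrow> (1 - t) *\<^sub>R x + t *\<^sub>R y \<in> C"
  using convex_C by (simp add: convex_alt)

lemma diff_in_Y: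
  assumes "x \<in> C" "y \<in> C"
  shows "x - y \<in> Y"
proof -
  have "u - p \<in> Y" if "u \<in> C" for u
    using that unfolding Y_def by (intro hull_inc) simp
  from subspace_diff[OF subspace_Y this[OF assms(1)] this[OF assms(2)]] show ?thesis by simp
qed

lemma ray_shrink:
  assumes "p + a *\<^sub>R v \<in> C" "0 \<le> b" "b \<le> a"
  shows "p + b *\<^sub>R v \<in> C"
proof (cases "a = 0")
  case False
  then have "(1 - b / a) *\<^sub>R p + (b / a) *\<^sub>R (p + a *\<^sub>R v) \<in> C"
    using assms p_in_C by (intro convex_combination) auto
  then show ?thesis using False by (simp add: algebra_simps)
qed (use assms in auto)

lemma Y_absorbing:
  assumes "v \<in> Y"
  obtains a where "0 < a" "a \<le> 1" "p + a *\<^sub>R v \<in> C"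
proof -
  obtain c e where c: "0 \<le> c" "e \<in> C" "v = c *\<^sub>R (e - p)"
    using assms by (auto simp: Y_def cone_hull_expl)
  show ?thesis
  proof (rule that)
    \<comment> \<open>The scale \<open>1 / (1 + c)\<close> also covers \<open>c = 0\<close> and
      never exceeds 1.\<close>
    have "p + 1 *\<^sub>R (e - p) \<in> C" using c by simp
    moreover have "c / (1 + c) \<le> 1" "0 \<le> c / (1 + c)" using c by auto
    ultimately have "p + (c / (1 + c)) *\<^sub>R (e - p) \<in> C" by (blast intro: ray_shrink)
    then show "p + (1 / (1 + c)) *\<^sub>R v \<in> C" by (simp add: c(3))
  qed (use c in auto)
qed

section \<open>Boundedness above relative to \<open>Y\<close>\<close>

text \<open>The sets \<open>T n\<close> are closed by lower semicontinuity and cover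
  \<open>Y\<close>, since \<open>C - p\<close> absorbs \<open>Y\<close> and convexity bounds
  \<open>F x\<close> on segments. Baire's theorem puts a ball around some \<open>v0\<close> into one
  of them; mixing with a point of \<open>C\<close> on the opposite ray recentres it at
  \<open>p\<close>.\<close>

lemma bounded_above_near_p:
  assumes x: "x \<in> C"
  obtains r M where "0 < r"
    "\<And>v. v \<in> Y \<Longrightarrow> norm v \<le> r \<Longrightarrow> p + v \<in> C \<and> F x (p + v) \<le> M"
proof -
  define S where "S a = {e \<in> C. F x e \<le> a}" for a
  define T where "T n = Y \<inter> (\<lambda>v. p + inverse (real (Suc n)) *\<^sub>R v) -` S (real (Suc n))" for n
  have "closed (T n)" for n
    unfolding T_def S_def
    by (intro closed_Int closed_Y continuous_closed_vimage closed_sublevel_lsc_on closed_C lsc_F x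
        continuous_intros)
  moreover have "Y \<subseteq> (\<Union>n. T n)"
  proof
    fix v assume v: "v \<in> Y"
    obtain a where a: "0 < a" "p + a *\<^sub>R v \<in> C" using Y_absorbing[OF v] by blast
    obtain n where n: "max (1 / a) (max (F x p) (F x (p + a *\<^sub>R v))) < real (Suc n)"
      by (meson less_SucI of_nat_less_iff order_less_trans reals_Archimedean2 lessI)
    define b where "b = inverse (real (Suc n))"
    define t where "t = b / a"
    have t: "0 \<le> t" "t \<le> 1"
      using n a(1) by (auto simp: t_def b_def field_simps simp del: of_nat_Suc)
    have eq: "(1 - t) *\<^sub>R p + t *\<^sub>R (p + a *\<^sub>R v) = p + b *\<^sub>R v"
      using a(1) by (simp add: t_def algebra_simps)
    have "F x (p + b *\<^sub>R v) \<le> (1 - t) * F x p + t * F x (p + a *\<^sub>R v)"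
      using convex_onD[OF convex_F[OF x] t p_in_C a(2)] by (simp only: eq)
    also have "\<dots> \<le> (1 - t) * real (Suc n) + t * real (Suc n)"
      using n t by (intro add_mono mult_left_mono) auto
    also have "\<dots> = real (Suc n)" by (simp add: algebra_simps)
    finally have "p + b *\<^sub>R v \<in> S (real (Suc n))"
      using convex_combination[OF t p_in_C a(2)] by (simp add: S_def eq)
    with v show "v \<in> (\<Union>n. T n)" by (auto simp: T_def b_def)
  qed
  moreover have "Y \<noteq> {}" using subspace_0[OF subspace_Y] by blast
  ultimately obtain n v0 r where r: "0 < r" "v0 \<in> Y" "Y \<inter> cball v0 r \<subseteq> T n"
    using Baire_closed[OF closed_Y, of T] by (metis T_def inf_le1)
  obtain a where a: "0 < a" "p + a *\<^sub>R (- v0) \<in> C"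
    using Y_absorbing subspace_neg[OF subspace_Y r(2)] by metis
  define N where "N = real (Suc n)"
  \<comment> \<open>With this weight \<open>t * inverse N = (1 - t) * a\<close>, so the multiples of
    \<open>v0\<close> cancel.\<close>
  define t where "t = a * N / (1 + a * N)"
  have N: "0 < N" by (simp add: N_def)
  have aN: "0 < a * N" using a N by simp
  have t: "0 < t" "t \<le> 1" "1 - t = 1 / (1 + a * N)"
    using aN by (auto simp: t_def field_simps)
  show ?thesis
  proof (rule that)
    show "0 < t * r / N" using t N r by simp
    fix v assume v: "v \<in> Y" "norm v \<le> t * r / N"
    define w where "w = (N / t) *\<^sub>R v"
    have "norm w \<le> r" using v(2) t N by (simp add: w_def field_simps)
    then have "v0 + w \<in> Y \<inter> cball v0 r"
      using v(1) r(2) subspace_Y by (simp add: w_def dist_norm subspace_add subspace_scale)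
    with r(3) have w: "p + inverse N *\<^sub>R (v0 + w) \<in> C" "F x (p + inverse N *\<^sub>R (v0 + w)) \<le> N"
      unfolding T_def S_def N_def by auto
    have "(1 - t) *\<^sub>R (p + a *\<^sub>R (- v0)) + t *\<^sub>R (p + inverse N *\<^sub>R (v0 + w)) =
        p + (t * inverse N - (1 - t) * a) *\<^sub>R v0 + (t * inverse N) *\<^sub>R w"
      by (simp add: algebra_simps)
    also have "t * inverse N - (1 - t) * a = 0"
      using N aN unfolding t(3) by (simp add: t_def field_simps)
    also have "(t * inverse N) *\<^sub>R w = v"
      using N t by (simp add: w_def)
    finally have eq: "(1 - t) *\<^sub>R (p + a *\<^sub>R (- v0)) + t *\<^sub>R (p + inverse N *\<^sub>R (v0 + w)) = p + v"
      by simp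
    have "F x (p + v) \<le> (1 - t) * F x (p + a *\<^sub>R (- v0)) + t * F x (p + inverse N *\<^sub>R (v0 + w))"
      using convex_onD[OF convex_F[OF x] _ t(2) a(2) w(1)] t(1) by (simp only: eq less_imp_le)
    also have "\<dots> \<le> (1 - t) * F x (p + a *\<^sub>R (- v0)) + t * N"
      using w(2) t(1) by (intro add_left_mono mult_left_mono) auto
    finally show "p + v \<in> C \<and> F x (p + v) \<le> (1 - t) * F x (p + a *\<^sub>R (- v0)) + t * N"
      using convex_combination[OF _ t(2) a(2) w(1)] t(1) by (simp only: eq less_imp_le)
  qed
qed

text \<open>The homothety with centre \<open>e\<close> and ratio \<open>s\<close> carries the ball
  around \<open>p\<close> to one around \<open>y\<close>.\<close>

lemma bounded_above_near:
  assumes x: "x \<in> C" and e: "e \<in> C" and s: "0 < s" "s \<le> 1"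
    and y: "y = (1 - s) *\<^sub>R e + s *\<^sub>R p"
  obtains r M where "0 < r"
    "\<And>v. v \<in> Y \<Longrightarrow> norm v \<le> r \<Longrightarrow> y + v \<in> C \<and> F x (y + v) \<le> M"
proof -
  obtain r M where r: "0 < r"
    "\<And>v. v \<in> Y \<Longrightarrow> norm v \<le> r \<Longrightarrow> p + v \<in> C \<and> F x (p + v) \<le> M"
    using bounded_above_near_p[OF x] by metis
  show ?thesis
  proof (rule that)
    show "0 < s * r" using s r by simp
    fix v assume v: "v \<in> Y" "norm v \<le> s * r"
    define w where "w = (1 / s) *\<^sub>R v"
    have "w \<in> Y" "norm w \<le> r"
      using v s subspace_scale[OF subspace_Y] by (auto simp: w_def field_simps)
    with r(2) have w: "p + w \<in> C" "F x (p + w) \<le> M" by auto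
    have eq: "(1 - s) *\<^sub>R e + s *\<^sub>R (p + w) = y + v"
      using s by (simp add: y w_def algebra_simps)
    have "F x (y + v) \<le> (1 - s) * F x e + s * F x (p + w)"
      using convex_onD[OF convex_F[OF x] _ s(2) e w(1)] s(1) by (simp only: eq less_imp_le)
    also have "\<dots> \<le> (1 - s) * F x e + s * M"
      using w(2) s(1) by (intro add_left_mono mult_left_mono) auto
    finally show "y + v \<in> C \<and> F x (y + v) \<le> (1 - s) * F x e + s * M"
      using convex_combination[OF _ s(2) e w(1)] s(1) by (simp add: eq less_imp_le)
  qed
qed

text \<open>
  The inequality asks for the growth condition under which the Hahn--Banach theorem produces a
  bounded subgradient with value \<open>c\<close> at \<open>d\<close>. It holds because the segment from \<open>e\<close> to a suitable
  point of the ball around \<open>x + d\<close> meets the line.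
\<close>

lemma calm_on_line:
  assumes x: "x \<in> C" and e: "e \<in> C" and s: "0 < s" "s \<le> 1"
    and d: "d = (1 - s) *\<^sub>R e + s *\<^sub>R p - x"
    and line: "\<And>t. x + t *\<^sub>R d \<in> C \<Longrightarrow> c * t \<le> F x (x + t *\<^sub>R d)"
  obtains K where "0 \<le> K"
    "\<And>e t. e \<in> C \<Longrightarrow> c * t - F x e \<le> K * norm (e - x - t *\<^sub>R d)"
proof -
  obtain r M where r: "0 < r"
    "\<And>v. v \<in> Y \<Longrightarrow> norm v \<le> r \<Longrightarrow> (x + d) + v \<in> C \<and> F x ((x + d) + v) \<le> M"
    using bounded_above_near[OF x e s, of "x + d"] d by auto
  have xd: "x + d \<in> C" and "F x (x + d) \<le> M"
    using r(2)[of 0] r(1) subspace_0[OF subspace_Y] by auto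
  with line[of 1] have cM: "c \<le> M" by simp
  have "d \<in> Y" using diff_in_Y[OF xd x] by simp
  show ?thesis
  proof (rule that)
    show "0 \<le> (M - c) / r" using cM r by simp
    fix e t assume e: "e \<in> C"
    define v where "v = e - x - t *\<^sub>R d"
    show "c * t - F x e \<le> (M - c) / r * norm (e - x - t *\<^sub>R d)"
    proof (cases "v = 0")
      case True
      then have "e = x + t *\<^sub>R d" by (simp add: v_def algebra_simps)
      with line[of t] e True show ?thesis by (simp add: v_def)
    next
      case False
      define \<delta> where "\<delta> = norm v"
      have \<delta>: "0 < \<delta>" using False by (simp add: \<delta>_def)
      define a where "a = r / (r + \<delta>)"
      have a: "0 \<le> a" "a \<le> 1" "1 - a = \<delta> / (r + \<delta>)"
        using r(1) \<delta> by (auto simp: a_def field_simps)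
      \<comment> \<open>\<open>w\<close> has length \<open>r\<close> and points opposite to
        \<open>v\<close>; the weight \<open>a\<close> makes the two cancel, so the convex
        combination lands on the line.\<close>
      define w where "w = - (r / \<delta>) *\<^sub>R v"
      have "v \<in> Y" unfolding v_def
        using diff_in_Y[OF e x] \<open>d \<in> Y\<close> subspace_Y by (simp add: subspace_diff subspace_scale)
      then have "w \<in> Y" using subspace_Y unfolding w_def by (intro subspace_scale)
      moreover have "norm w \<le> r" using r(1) \<delta> by (simp add: w_def flip: \<delta>_def)
      ultimately have w: "x + d + w \<in> C" "F x (x + d + w) \<le> M" using r(2) by auto
      have "(1 - a) *\<^sub>R (x + d + w) + a *\<^sub>R e =
          x + (a * t + (1 - a)) *\<^sub>R d + (a *\<^sub>R v + (1 - a) *\<^sub>R w)"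
        by (simp add: v_def algebra_simps)
      also have "a *\<^sub>R v + (1 - a) *\<^sub>R w = (a - (1 - a) * (r / \<delta>)) *\<^sub>R v"
        by (simp add: w_def algebra_simps)
      also have "a - (1 - a) * (r / \<delta>) = 0"
        unfolding a(3) using \<delta> by (simp add: a_def)
      finally have eq: "(1 - a) *\<^sub>R (x + d + w) + a *\<^sub>R e = x + (a * t + (1 - a)) *\<^sub>R d"
        by simp
      \<comment> \<open>At the meeting point \<open>line\<close> bounds \<open>F x\<close> from
        below, convexity and \<open>M\<close> from above.\<close>
      have "c * (a * t + (1 - a)) \<le> F x (x + (a * t + (1 - a)) *\<^sub>R d)"
        using line convex_combination[OF a(1,2) w(1) e] by (simp only: eq)
      also have "\<dots> \<le> (1 - a) * F x (x + d + w) + a * F x e"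
        using convex_onD[OF convex_F[OF x] a(1,2) w(1) e] by (simp only: eq)
      also have "\<dots> \<le> (1 - a) * M + a * F x e"
        using w(2) a by (intro add_right_mono mult_left_mono) auto
      finally have "a * (c * t - F x e) \<le> (1 - a) * (M - c)"
        by (simp add: algebra_simps)
      then have "r * (c * t - F x e) / (r + \<delta>) \<le> \<delta> * (M - c) / (r + \<delta>)"
        unfolding a(3) by (simp add: a_def)
      then have "r * (c * t - F x e) \<le> \<delta> * (M - c)"
        using r(1) \<delta> by (simp add: divide_le_cancel)
      then show ?thesis
        using r(1) unfolding v_def[symmetric] \<delta>_def[symmetric] by (simp add: field_simps)
    qed
  qed
qed

section \<open>Operator elements with a prescribed value\<close>

lemma operator_element_on_line:
  assumes x: "x \<in> C" and e: "e \<in> C" and s: "0 < s" "s \<le> 1"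
    and d: "d = (1 - s) *\<^sub>R e + s *\<^sub>R p - x"
    and line: "\<And>t. x + t *\<^sub>R d \<in> C \<Longrightarrow> c * t \<le> F x (x + t *\<^sub>R d)"
  obtains u where "u \<in> bifunction_operator C F x" "blinfun_apply u d = c"
proof -
  obtain K where "0 \<le> K" "\<And>e t. e \<in> C \<Longrightarrow> c * t - F x e \<le> K * norm (e - x - t *\<^sub>R d)"
    using calm_on_line[OF x e s d line] by metis
  then obtain u where "\<And>e. e \<in> C \<Longrightarrow> blinfun_apply u (e - x) \<le> F x e" "blinfun_apply u d = c"
    using subgradient_prescribed_on_line[OF convex_F[OF x] x diag[OF x]] by metis
  then show ?thesis using that x diag by (auto simp: bifunction_operator_def)
qed

text \<open>As \<open>Y\<close> is closed, \<open>d\<close> keeps a distance \<eta> from it, so the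
  norm of \<open>e - p - t *\<^sub>R d\<close> controls \<open>t\<close>. Hence \<open>c * t\<close>
  is absorbed by a large \<open>M\<close>, whatever \<open>c\<close> is.\<close>

lemma operator_element_off_Y:
  assumes d: "d \<notin> Y"
  obtains u where "u \<in> bifunction_operator C F p" "blinfun_apply u d = c"
proof -
  \<comment> \<open>In direction \<open>0\<close> with slope \<open>0\<close>, the line hypothesis
    reduces to \<open>F p p = 0\<close>.\<close>
  obtain K where K: "0 \<le> K" "\<And>e. e \<in> C \<Longrightarrow> - F p e \<le> K * norm (e - p)"
    using calm_on_line[OF p_in_C p_in_C, of 1 0 0] diag[OF p_in_C] by auto
  obtain \<eta> where \<eta>: "0 < \<eta>" "\<And>y. y \<in> Y \<Longrightarrow> \<eta> \<le> norm (d - y)"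
  proof -
    obtain \<eta> where "0 < \<eta>" "ball d \<eta> \<subseteq> - Y"
      using closed_Y d by (meson ComplI open_Compl open_contains_ball)
    then show ?thesis using that[of \<eta>] by (force simp: dist_norm subset_iff)
  qed
  define M where "M = K + (\<bar>c\<bar> + K * norm d) / \<eta>"
  have "c * t - F p e \<le> M * norm (e - p - t *\<^sub>R d)" if e: "e \<in> C" for e t
  proof -
    define \<delta> where "\<delta> = norm (e - p - t *\<^sub>R d)"
    have t: "\<bar>t\<bar> \<le> \<delta> / \<eta>"
    proof (cases "t = 0")
      case False
      have "\<eta> \<le> norm (d - (1 / t) *\<^sub>R (e - p))"
        using \<eta>(2) subspace_scale[OF subspace_Y diff_in_Y[OF e p_in_C]] by blast
      then have "\<bar>t\<bar> * \<eta> \<le> norm (t *\<^sub>R (d - (1 / t) *\<^sub>R (e - p)))"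
        by (simp add: mult_left_mono)
      also have "t *\<^sub>R (d - (1 / t) *\<^sub>R (e - p)) = - (e - p - t *\<^sub>R d)"
        using False by (simp add: algebra_simps)
      finally have "\<bar>t\<bar> * \<eta> \<le> \<delta>" by (simp only: norm_minus_cancel \<delta>_def)
      then show ?thesis using \<eta>(1) by (simp add: field_simps)
    qed (use \<eta> in \<open>simp add: \<delta>_def\<close>)
    have "norm (e - p) \<le> \<delta> + \<bar>t\<bar> * norm d"
      using norm_triangle_ineq[of "e - p - t *\<^sub>R d" "t *\<^sub>R d"] by (simp add: \<delta>_def)
    then have "- F p e \<le> K * (\<delta> + \<bar>t\<bar> * norm d)"
      using K(2)[OF e] K(1) by (meson mult_left_mono order_trans)
    moreover have "c * t \<le> \<bar>c\<bar> * \<bar>t\<bar>" by (metis abs_ge_self abs_mult)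
    ultimately have "c * t - F p e \<le> K * \<delta> + (\<bar>c\<bar> + K * norm d) * \<bar>t\<bar>"
      by (simp add: algebra_simps)
    also have "\<dots> \<le> K * \<delta> + (\<bar>c\<bar> + K * norm d) * (\<delta> / \<eta>)"
      using t K(1) by (intro add_left_mono mult_left_mono) auto
    also have "\<dots> = M * \<delta>" by (simp add: M_def add_divide_distrib algebra_simps)
    finally show ?thesis by (simp add: \<delta>_def)
  qed
  moreover have "0 \<le> M" using K(1) \<eta>(1) by (simp add: M_def)
  ultimately obtain u where "\<And>e. e \<in> C \<Longrightarrow> blinfun_apply u (e - p) \<le> F p e" "blinfun_apply u d = c"
    using subgradient_prescribed_on_line[OF convex_F[OF p_in_C] p_in_C diag[OF p_in_C]] by metis
  then show ?thesis using that p_in_C diag by (auto simp: bifunction_operator_def)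
qed

section \<open>Points \<open>z\<close> with \<open>(z, 0)\<close> monotonically related to the
  graph\<close>

context
  fixes z :: 'a
  assumes related: "\<And>x u. u \<in> bifunction_operator C F x \<Longrightarrow> 0 \<le> blinfun_apply u (x - z)"
begin

text \<open>By upper hemicontinuity a negative value at \<open>w\<close> persists at some
  \<open>x\<close> between \<open>w\<close> and \<open>y\<close>. Since \<open>C\<close> has room
  behind \<open>x\<close>, a negative slope exists there and is realised by some \<open>u\<close> in
  the operator; \<open>x - z\<close> is a positive multiple of \<open>y - x\<close>, so relatedness
  fails.\<close>

lemma nonneg_towards_relative_interior:
  assumes e: "e \<in> C" and s: "0 < s" "s \<le> 1" and y: "y = (1 - s) *\<^sub>R e + s *\<^sub>R p"
    and w: "w \<in> C" "w = z + \<sigma> *\<^sub>R (y - z)" and \<sigma>: "0 \<le> \<sigma>" "\<sigma> < 1"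
  shows "0 \<le> F w y"
proof (rule ccontr)
  assume "\<not> 0 \<le> F w y"
  then have neg: "F w y < 0" by simp
  have yC: "y \<in> C"
    unfolding y using s by (intro convex_combination e p_in_C) auto
  with neg diag have "w \<noteq> y" by force
  have seg: "closed_segment w y \<subseteq> C"
    using closed_segment_subset[OF w(1) yC convex_C] .
  then have "usc_on (closed_segment w y) (\<lambda>x. F x y)"
    using uhc_F[OF yC] by (simp add: upper_hemicontinuous_on_def)
  then have "\<forall>\<^sub>F x in at w within closed_segment w y. F x y < 0"
    using neg by (simp add: usc_on_def)
  then obtain \<delta> where \<delta>: "0 < \<delta>"
    "\<And>x. x \<in> closed_segment w y \<Longrightarrow> x \<noteq> w \<Longrightarrow> dist x w < \<delta> \<Longrightarrow> F x y < 0"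
    by (auto simp: eventually_at)
  \<comment> \<open>The bound \<open>1 / 2\<close> keeps \<open>x\<close> short of \<open>y\<close>;
    the other places it within \<delta> of \<open>w\<close>.\<close>
  define \<tau> where "\<tau> = min (1 / 2) (\<delta> / (2 * norm (y - w)))"
  have \<tau>: "0 < \<tau>" "\<tau> < 1" using \<delta>(1) \<open>w \<noteq> y\<close> by (auto simp: \<tau>_def)
  define x where "x = (1 - \<tau>) *\<^sub>R w + \<tau> *\<^sub>R y"
  have xw: "x - w = \<tau> *\<^sub>R (y - w)" by (simp add: x_def algebra_simps)
  have xseg: "x \<in> closed_segment w y"
    using \<tau> by (auto simp: x_def closed_segment_def)
  then have xC: "x \<in> C" using seg by blast
  have "\<tau> * norm (y - w) \<le> \<delta> / (2 * norm (y - w)) * norm (y - w)"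
    by (intro mult_right_mono) (auto simp: \<tau>_def)
  also have "\<dots> < \<delta>" using \<delta>(1) \<open>w \<noteq> y\<close> by simp
  finally have "dist x w < \<delta>" using \<tau> by (simp add: dist_norm xw)
  moreover have "x \<noteq> w" using xw \<tau> \<open>w \<noteq> y\<close> by auto
  ultimately have Fxy: "F x y < 0" using \<delta>(2) xseg by blast
  define d where "d = y - x"
  have d: "d = (1 - \<tau>) *\<^sub>R (y - w)" by (simp add: d_def x_def algebra_simps)
  \<comment> \<open>Going back from \<open>x\<close> along \<open>d\<close> reaches
    \<open>w\<close>, the point of \<open>C\<close> behind \<open>x\<close> that
    \<open>convex_on_line_subgradient\<close> asks for.\<close>
  have "(\<tau> / (1 - \<tau>)) *\<^sub>R d = x - w"
    using \<tau> unfolding d xw by simp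
  then have "x - (\<tau> / (1 - \<tau>)) *\<^sub>R d = w" by simp
  then obtain c where c: "c \<le> F x (x + d)"
    "\<And>t. x + t *\<^sub>R d \<in> C \<Longrightarrow> c * t \<le> F x (x + t *\<^sub>R d)"
    using convex_on_line_subgradient[OF convex_F[OF xC] xC diag[OF xC], of "\<tau> / (1 - \<tau>)" d]
      \<tau> w(1) yC by (auto simp: d_def)
  then obtain u where u: "u \<in> bifunction_operator C F x" "blinfun_apply u d = c"
    using operator_element_on_line[OF xC e s, of d c] by (auto simp: d_def y)
  \<comment> \<open>The ratio of \<open>x - z\<close> to \<open>d\<close>, both being positive
    multiples of \<open>y - z\<close>.\<close>
  define \<rho> where "\<rho> = (\<sigma> + \<tau> * (1 - \<sigma>)) / ((1 - \<tau>) * (1 - \<sigma>))"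
  have "0 < \<rho>" using \<sigma> \<tau> unfolding \<rho>_def
    by (intro divide_pos_pos mult_pos_pos add_nonneg_pos) auto
  have yw: "y - w = (1 - \<sigma>) *\<^sub>R (y - z)" by (simp add: w algebra_simps)
  have "x - z = (x - w) + (w - z)" by simp
  also have "\<dots> = (\<tau> * (1 - \<sigma>) + \<sigma>) *\<^sub>R (y - z)"
    unfolding xw yw using w(2) by (simp add: algebra_simps)
  also have "\<dots> = \<rho> *\<^sub>R d"
    using \<sigma> \<tau> unfolding d yw by (simp add: \<rho>_def add.commute)
  finally have "blinfun_apply u (x - z) = \<rho> * c" using u(2) by (simp add: blinfun.scaleR_right)
  moreover have "c < 0" using c(1) Fxy by (simp add: d_def)
  ultimately show False
    using related[OF u(1)] \<open>0 < \<rho>\<close> mult_pos_neg[of \<rho> c] by simp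
qed

lemma related_point_in_domain: "z \<in> C"
proof (rule ccontr)
  assume z: "z \<notin> C"
  have "p - z \<in> Y"
  proof (rule ccontr)
    assume "p - z \<notin> Y"
    then obtain u where "u \<in> bifunction_operator C F p" "blinfun_apply u (p - z) = - 1"
      using operator_element_off_Y by metis
    with related[of u p] show False by simp
  qed
  then have zY: "z - p \<in> Y" using subspace_neg[OF subspace_Y] by fastforce
  \<comment> \<open>The maximum \<tau> of these parameters marks the point \<open>w\<close> where
    the segment from \<open>p\<close> to \<open>z\<close> leaves \<open>C\<close>.\<close>
  define S where "S = {0..1} \<inter> (\<lambda>t. p + t *\<^sub>R (z - p)) -` C"
  have "compact S"
    unfolding S_def using closed_C
    by (intro compact_Int_closed continuous_closed_vimage continuous_intros) auto
  moreover have "0 \<in> S" using p_in_C by (simp add: S_def)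
  ultimately obtain \<tau> where \<tau>S: "\<tau> \<in> S" and max: "\<And>t. t \<in> S \<Longrightarrow> t \<le> \<tau>"
    using compact_attains_sup[of S] by blast
  obtain a where "0 < a" "a \<in> S"
    using Y_absorbing[OF zY] by (auto simp: S_def)
  then have \<tau>0: "0 < \<tau>" using max by force
  have \<tau>1: "\<tau> < 1" using \<tau>S z by (cases "\<tau> = 1") (auto simp: S_def)
  define w where "w = p + \<tau> *\<^sub>R (z - p)"
  have wC: "w \<in> C" using \<tau>S by (simp add: S_def w_def)
  define d where "d = p - w"
  have wd: "w + t *\<^sub>R d = p + (\<tau> * (1 - t)) *\<^sub>R (z - p)" for t
    by (simp add: d_def w_def algebra_simps)
  have wd': "w + t *\<^sub>R d = (1 - t) *\<^sub>R w + t *\<^sub>R p" for t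
    by (simp add: d_def algebra_simps)
  have F_nonneg: "0 \<le> F w (w + t *\<^sub>R d)" if t: "0 < t" "t \<le> 1" for t
  proof -
    have pos: "0 < 1 - \<tau> * (1 - t)"
      using \<tau>0 \<tau>1 t mult_le_one[of \<tau> "1 - t"] mult_less_le_imp_less[of \<tau> 1 "1 - t" 1]
      by (smt (verit) mult_left_le)
    \<comment> \<open>The position of \<open>w\<close> on the segment from \<open>z\<close> to
      \<open>w + t *\<^sub>R d\<close>.\<close>
    define \<sigma> where "\<sigma> = (1 - \<tau>) / (1 - \<tau> * (1 - t))"
    have \<sigma>: "0 \<le> \<sigma>" "\<sigma> < 1"
      using pos \<tau>0 \<tau>1 t by (auto simp: \<sigma>_def field_simps)
    have "w + t *\<^sub>R d - z = (1 - \<tau> * (1 - t)) *\<^sub>R (p - z)"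
      unfolding wd by (simp add: algebra_simps)
    then have "\<sigma> *\<^sub>R (w + t *\<^sub>R d - z) = (1 - \<tau>) *\<^sub>R (p - z)"
      using pos by (simp add: \<sigma>_def)
    then have "w = z + \<sigma> *\<^sub>R (w + t *\<^sub>R d - z)"
      by (simp add: w_def algebra_simps)
    then show ?thesis
      using nonneg_towards_relative_interior[OF wC t wd' wC _ \<sigma>] by blast
  qed
  have line: "- 1 * t \<le> F w (w + t *\<^sub>R d)" if wt: "w + t *\<^sub>R d \<in> C" for t
  proof -
    \<comment> \<open>A point with \<open>t < 0\<close> would exceed the maximal \<tau>, or put
      \<open>z\<close> into \<open>C\<close>. For \<open>t > 1\<close>, convexity and
      \<open>F w w = 0\<close> propagate the sign at \<open>w + d\<close>.\<close>
    consider "t < 0" | "t = 0" | "0 < t" "t \<le> 1" | "1 < t" by linarith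
    then show ?thesis
    proof cases
      case 1
      then have gt: "\<tau> < \<tau> * (1 - t)" using \<tau>0 by simp
      have "\<tau> * (1 - t) < 1"
        using ray_shrink[OF wt[unfolded wd], of 1] z by force
      then have "\<tau> * (1 - t) \<in> S" using wt gt \<tau>0 by (simp add: S_def wd)
      with max gt show ?thesis by force
    next
      case 2
      then show ?thesis using diag[OF wC] by simp
    next
      case 3
      then show ?thesis using F_nonneg[of t] by simp
    next
      case 4
      have "(1 - 1 / t) *\<^sub>R w + (1 / t) *\<^sub>R (w + t *\<^sub>R d) = w + d"
        using 4 by (simp add: algebra_simps)
      then have "0 \<le> 1 / t * F w (w + t *\<^sub>R d)"
        using convex_onD[OF convex_F[OF wC] _ _ wC wt, of "1 / t"] 4 F_nonneg[of 1] diag[OF wC]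
        by simp
      then have "0 \<le> F w (w + t *\<^sub>R d)" using 4 by (simp add: zero_le_divide_iff)
      with 4 show ?thesis by simp
    qed
  qed
  obtain u where u: "u \<in> bifunction_operator C F w" "blinfun_apply u d = - 1"
    using operator_element_on_line[OF wC p_in_C, of 1 d "- 1"] line by (auto simp: d_def)
  \<comment> \<open>\<open>w - z\<close> is a positive multiple of \<open>d\<close>, where
    \<open>u\<close> is negative.\<close>
  have "d = \<tau> *\<^sub>R (p - z)" by (simp add: d_def w_def algebra_simps)
  then have "((1 - \<tau>) / \<tau>) *\<^sub>R d = (1 - \<tau>) *\<^sub>R (p - z)" using \<tau>0 by simp
  then have "w - z = ((1 - \<tau>) / \<tau>) *\<^sub>R d" by (simp add: w_def algebra_simps)
  then have "blinfun_apply u (w - z) = - ((1 - \<tau>) / \<tau>)"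
    using u(2) by (simp add: blinfun.scaleR_right)
  with related[OF u(1)] \<tau>0 \<tau>1 show False by (simp add: field_simps)
qed

text \<open>The case \<open>w = z\<close>, \<sigma> = 0 gives nonnegativity at points of the segment
  from \<open>e\<close> to \<open>p\<close> other than \<open>e\<close>; convexity transfers it to
  \<open>e\<close> as \<open>s\<close> tends to 0.\<close>

lemma related_point_solves:
  assumes e: "e \<in> C"
  shows "0 \<le> F z e"
proof (rule ccontr)
  assume "\<not> 0 \<le> F z e"
  note zC = related_point_in_domain
  have le: "0 \<le> (1 - s) * F z e + s * F z p" if s: "0 < s" "s \<le> 1" for s
    using nonneg_towards_relative_interior[OF e s refl zC, of 0]
      convex_onD[OF convex_F[OF zC] _ s(2) e p_in_C] s(1) by simp
  define a b where "a = - F z e" and "b = F z p"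
  have ab: "0 < a" "0 \<le> b" using \<open>\<not> 0 \<le> F z e\<close> le[of 1] by (auto simp: a_def b_def)
  \<comment> \<open>Small enough that the convexity bound equals \<open>- a / 2\<close>, which
    replaces the limit.\<close>
  define s where "s = a / (2 * (a + b))"
  have "0 \<le> (1 - s) * F z e + s * F z p"
    using ab by (intro le) (auto simp: s_def field_simps)
  also have "\<dots> = s * (a + b) - a"
    by (simp add: a_def b_def algebra_simps)
  also have "\<dots> = - a / 2" using ab by (simp add: s_def field_simps)
  finally show False using ab by simp
qed

end

end

section \<open>Shift by a functional, and maximality\<close>

text \<open>The subtracted term is continuous, affine in \<open>y\<close> and zero on the diagonal,
  so the hypotheses survive. This reduces general \<open>v\<close> to \<open>0\<close>.\<close>

lemma sqri_bifunction_translate: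
  assumes "sqri_bifunction C F p"
  shows "sqri_bifunction C (\<lambda>x y. F x y - blinfun_apply v (y - x)) p"
proof -
  interpret sqri_bifunction C F p by fact
  show ?thesis
  proof
    show "closed C" "p \<in> sqri C" by (fact closed_C sqri)+
    show "F x x - blinfun_apply v (x - x) = 0" if "x \<in> C" for x
      using diag[OF that] by simp
    show "convex_on C (\<lambda>y. F x y - blinfun_apply v (y - x))" if x: "x \<in> C" for x
    proof (rule convex_onI)
      fix t a b assume "0 < (t::real)" "t < 1" "a \<in> C" "b \<in> C"
      moreover have "(1 - t) *\<^sub>R a + t *\<^sub>R b - x = (1 - t) *\<^sub>R (a - x) + t *\<^sub>R (b - x)"
        by (simp add: algebra_simps)
      ultimately show "F x ((1 - t) *\<^sub>R a + t *\<^sub>R b) - blinfun_apply v ((1 - t) *\<^sub>R a + t *\<^sub>R b - x) \<le>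
          (1 - t) * (F x a - blinfun_apply v (a - x)) + t * (F x b - blinfun_apply v (b - x))"
        using convex_onD[OF convex_F[OF x], of t a b]
        by (simp add: blinfun.add_right blinfun.scaleR_right) (simp add: algebra_simps)
    qed (rule convex_C)
    show "lsc_on C (\<lambda>y. F x y - blinfun_apply v (y - x))" if x: "x \<in> C" for x
      using lsc_on_add_continuous[OF lsc_F[OF x], of "\<lambda>y. - blinfun_apply v (y - x)"]
      by (simp add: continuous_intros)
    show "upper_hemicontinuous_on C (\<lambda>x. F x y - blinfun_apply v (y - x))" if y: "y \<in> C" for y
      unfolding upper_hemicontinuous_on_def
    proof (intro allI impI)
      fix a b assume "closed_segment a b \<subseteq> C"
      then have "usc_on (closed_segment a b) (\<lambda>x. F x y)"
        using uhc_F[OF y] by (simp add: upper_hemicontinuous_on_def)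
      from usc_on_add_continuous[OF this, of "\<lambda>x. - blinfun_apply v (y - x)"]
      show "usc_on (closed_segment a b) (\<lambda>x. F x y - blinfun_apply v (y - x))"
        by (simp add: continuous_intros)
    qed
  qed
qed

text \<open>Adding \<open>v\<close> maps the operator of the shifted bifunction into that of
  \<open>F\<close>, so \<open>(z, 0)\<close> is related to the shifted graph.\<close>

lemma (in sqri_bifunction) monotonically_related_imp_operator:
  assumes "\<And>x u. u \<in> bifunction_operator C F x \<Longrightarrow> 0 \<le> blinfun_apply (u - v) (x - z)"
  shows "v \<in> bifunction_operator C F z"
proof -
  interpret G: sqri_bifunction C "\<lambda>x y. F x y - blinfun_apply v (y - x)" p
    by (rule sqri_bifunction_translate) unfold_locales
  have "0 \<le> blinfun_apply u (x - z)"
    if "u \<in> bifunction_operator C (\<lambda>x y. F x y - blinfun_apply v (y - x)) x" for x u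
  proof -
    have "u + v \<in> bifunction_operator C F x"
      using that by (auto simp: bifunction_operator_def blinfun.add_left split: if_splits)
    from assms[OF this] show ?thesis by simp
  qed
  from G.related_point_in_domain[OF this] G.related_point_solves[OF this] show ?thesis
    using diag by (simp add: bifunction_operator_def)
qed

lemma monotone_operator_bifunction_operator:
  assumes F: "monotone_bifunction C F" and diag: "\<And>x. x \<in> C \<Longrightarrow> F x x = 0"
  shows "monotone_operator (bifunction_operator C F)"
  unfolding monotone_operator_def
proof (intro allI ballI)
  fix x y xs ys
  assume xs: "xs \<in> bifunction_operator C F x" and ys: "ys \<in> bifunction_operator C F y"
  then have C: "x \<in> C" "y \<in> C" by (auto simp: bifunction_operator_def split: if_splits)
  have "blinfun_apply xs (y - x) \<le> F x y" "blinfun_apply ys (x - y) \<le> F y x"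
    using xs ys C diag by (auto simp: bifunction_operator_def)
  moreover have "F x y + F y x \<le> 0"
    using F C by (simp add: monotone_bifunction_def)
  moreover have "blinfun_apply ys (x - y) = - blinfun_apply ys (y - x)"
    by (metis blinfun.minus_right minus_diff_eq)
  ultimately show "0 \<le> blinfun_apply (ys - xs) (y - x)"
    by (simp add: blinfun.diff_left)
qed

theorem theorem9:
  fixes C :: "'a::banach set" and F :: "'a \<Rightarrow> 'a \<Rightarrow> real"
  assumes "\<exists>x::'a. x \<noteq> 0"
    and "C \<noteq> {}" and "convex C" and "closed C"
    and "monotone_bifunction C F"
    and "\<And>x. x \<in> C \<Longrightarrow> F x x = 0"
    and "sqri C \<noteq> {}"
    and "\<And>x. x \<in> C \<Longrightarrow> convex_on C (F x)"
    and "\<And>x. x \<in> C \<Longrightarrow> lsc_on C (F x)"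
    and "\<And>y. y \<in> C \<Longrightarrow> upper_hemicontinuous_on C (\<lambda>x. F x y)"
  shows "maximal_monotone_bifunction C F"
proof -
  obtain p where "p \<in> sqri C" using assms(7) by blast
  then interpret sqri_bifunction C F p
    using assms by unfold_locales
  have "operator_graph S \<subseteq> operator_graph (bifunction_operator C F)"
    if S: "monotone_operator S" "operator_graph (bifunction_operator C F) \<subseteq> operator_graph S" for S
  proof -
    \<comment> \<open>A pair in a monotone extension is related to the whole smaller graph.\<close>
    have "v \<in> bifunction_operator C F z" if "v \<in> S z" for z v
    proof (rule monotonically_related_imp_operator)
      fix x u assume "u \<in> bifunction_operator C F x"
      then have "u \<in> S x" using S(2) by (auto simp: operator_graph_def)
      with that S(1) show "0 \<le> blinfun_apply (u - v) (x - z)"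
        by (simp add: monotone_operator_def)
    qed
    then show ?thesis by (auto simp: operator_graph_def)
  qed
  then have "maximal_monotone_operator (bifunction_operator C F)"
    using monotone_operator_bifunction_operator[OF assms(5,6)]
    by (auto simp: maximal_monotone_operator_def)
  with assms(5) show ?thesis by (simp add: maximal_monotone_bifunction_def)
qed

end
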